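(* Let $L$ be a residuated lattice satisfying the descending chain condition on filters. If $(L,\mathcal U)$ is a zero-dimensional linear topological residuated lattice, then there exists a filter $F_0$ of $L$ such that $\mathcal U=\mathcal T_{F_0}$. In particular, on a residuated lattice satisfying the descending chain condition, every zero-dimensional linear topology (making $L$ a topological residuated lattice) is induced by a single filter, and hence by a singleton system of filters.
   Context: A residuated lattice is an algebra $(L,\wedge,\vee,\odot,\rightarrow,0,1)$ such that $(L,\wedge,\vee,0,1)$ is a bounded lattice, $(L,\odot,1)$ is a commutative monoid, and $x\odot y\leq z$ iff $x\leq y\rightarrow z$ for all $x,y,z\in L$. A filter of $L$ is a nonempty subset $F\subseteq L$ closed under $\odot$ and upward closed. $L$ satisfies the descending chain condition if every strictly descending chain of filters of $L$ is finite. For a filter $F$, $x/F=\{y\in L:(x\to y)\odot(y\to x)\in F\}$, and $\mathcal T_F=\{U\subseteq L:\forall x\in U,\ x/F\subseteq U\}$, the topology induced by $F$ (equivalently, by the singleton system $\{F\}$). A topological residuated lattice is a residuated lattice with a topology making all operations continuous. A topology on $L$ is linear if it has a base $\beta$ such that, for all $B\in\beta$, $B$ is a filter if and only if $1\in B$. A topology is zero-dimensional if it has a base of clopen sets. A zero-dimensional linear topological residuated lattice is a topological residuated lattice whose topology is linear and zero-dimensional. *)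

theory Defs
  imports "HOL-Analysis.Analysis"
begin

text \<open>The lattice bounds \<open>0\<close> and \<open>1\<close> are \<open>bot\<close> and \<open>top\<close>; the monoid operation is \<open>*\<close>,
  whose unit \<open>1\<close> is required to be the top element. Degenerate algebras (\<open>bot = top\<close>) are
  not excluded.\<close>

class residuated_lattice = bounded_lattice + comm_monoid_mult +
  fixes residuum :: "'a \<Rightarrow> 'a \<Rightarrow> 'a"  (infixr \<open>\<rightharpoonup>\<close> 60)
  assumes one_eq_top: "1 = top"
    and residuation: "x * y \<le> z \<longleftrightarrow> x \<le> y \<rightharpoonup> z"

definition rl_filter :: "'a::residuated_lattice set \<Rightarrow> bool" where
  "rl_filter F \<longleftrightarrow>
     F \<noteq> {} \<and> (\<forall>x\<in>F. \<forall>y\<in>F. x * y \<in> F) \<and> (\<forall>x\<in>F. \<forall>y. x \<le> y \<longrightarrow> y \<in> F)"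

definition filter_dcc :: "'a::residuated_lattice itself \<Rightarrow> bool" where
  "filter_dcc _ \<longleftrightarrow>
     \<not> (\<exists>F :: nat \<Rightarrow> 'a set. (\<forall>n. rl_filter (F n)) \<and> (\<forall>n. F (Suc n) \<subset> F n))"

definition filter_class :: "'a::residuated_lattice \<Rightarrow> 'a set \<Rightarrow> 'a set" where
  "filter_class x F = {y. (x \<rightharpoonup> y) * (y \<rightharpoonup> x) \<in> F}"

definition filter_topology :: "'a::residuated_lattice set \<Rightarrow> 'a topology" where
  "filter_topology F = topology (\<lambda>U. \<forall>x\<in>U. filter_class x F \<subseteq> U)"

lemma openin_filter_topology:
  "openin (filter_topology F) U \<longleftrightarrow> (\<forall>x\<in>U. filter_class x F \<subseteq> U)"
proof -
  have "istopology (\<lambda>U. \<forall>x\<in>U. filter_class x F \<subseteq> U)"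
    unfolding istopology_def by blast
  then show ?thesis
    by (simp add: filter_topology_def)
qed

text \<open>A system of filters is a family indexed by an upward directed set, with larger indices
  giving smaller filters. Only the set of its members matters for the induced topology, so
  systems are rendered as nonempty, downward directed sets of filters.\<close>

definition filter_system :: "'a::residuated_lattice set set \<Rightarrow> bool" where
  "filter_system S \<longleftrightarrow>
     S \<noteq> {} \<and> (\<forall>F\<in>S. rl_filter F) \<and> (\<forall>F\<in>S. \<forall>G\<in>S. \<exists>H\<in>S. H \<subseteq> F \<inter> G)"

definition system_topology :: "'a::residuated_lattice set set \<Rightarrow> 'a topology" where
  "system_topology S = topology (\<lambda>U. \<forall>x\<in>U. \<exists>F\<in>S. filter_class x F \<subseteq> U)"

lemma openin_system_topology:
  assumes "filter_system S"
  shows "openin (system_topology S) U \<longleftrightarrow> (\<forall>x\<in>U. \<exists>F\<in>S. filter_class x F \<subseteq> U)"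
proof -
  have mono: "filter_class x H \<subseteq> filter_class x F" if "H \<subseteq> F" for x :: 'a and H F
    using that by (auto simp: filter_class_def)
  have "istopology (\<lambda>U. \<forall>x\<in>U. \<exists>F\<in>S. filter_class x F \<subseteq> U)"
    unfolding istopology_def
  proof (intro conjI allI impI ballI)
    fix A B x
    assume "\<forall>x\<in>A. \<exists>F\<in>S. filter_class x F \<subseteq> A" "\<forall>x\<in>B. \<exists>F\<in>S. filter_class x F \<subseteq> B"
      and "x \<in> A \<inter> B"
    then obtain F G where FG: "F \<in> S" "G \<in> S" "filter_class x F \<subseteq> A" "filter_class x G \<subseteq> B"
      by blast
    then obtain H where "H \<in> S" "H \<subseteq> F" "H \<subseteq> G"
      using assms unfolding filter_system_def by (metis le_inf_iff)
    then show "\<exists>H\<in>S. filter_class x H \<subseteq> A \<inter> B"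
      using FG mono by (metis le_inf_iff order_trans)
  next
    fix K x
    assume "\<forall>U\<in>K. \<forall>x\<in>U. \<exists>F\<in>S. filter_class x F \<subseteq> U" "x \<in> \<Union>K"
    then show "\<exists>F\<in>S. filter_class x F \<subseteq> \<Union>K"
      by (meson UnionE Union_upper order_trans)
  qed
  then show ?thesis
    by (simp add: system_topology_def)
qed

definition base_of :: "'a set set \<Rightarrow> 'a topology \<Rightarrow> bool" where
  "base_of \<B> T \<longleftrightarrow> openin T = arbitrary union_of (\<lambda>B. B \<in> \<B>)"

definition topological_residuated_lattice :: "'a::residuated_lattice topology \<Rightarrow> bool" where
  "topological_residuated_lattice T \<longleftrightarrow>
     topspace T = UNIV \<and>
     continuous_map (prod_topology T T) T (\<lambda>(x, y). inf x y) \<and>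
     continuous_map (prod_topology T T) T (\<lambda>(x, y). sup x y) \<and>
     continuous_map (prod_topology T T) T (\<lambda>(x, y). x * y) \<and>
     continuous_map (prod_topology T T) T (\<lambda>(x, y). x \<rightharpoonup> y)"

definition linear_topology :: "'a::residuated_lattice topology \<Rightarrow> bool" where
  "linear_topology T \<longleftrightarrow>
     (\<exists>\<beta>. base_of \<beta> T \<and> (\<forall>B\<in>\<beta>. rl_filter B \<longleftrightarrow> 1 \<in> B))"

definition zero_dimensional :: "'a topology \<Rightarrow> bool" where
  "zero_dimensional T \<longleftrightarrow>
     (\<exists>\<B>. base_of \<B> T \<and> (\<forall>B\<in>\<B>. openin T B \<and> closedin T B))"

end

theory Submission
  imports Defs
begin

text \<open>
  Linearity makes the open filters a neighbourhood base at \<open>1\<close>, so by the descending chain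
  condition there is a least open filter \<open>F\<^sub>0\<close>, contained in every neighbourhood of \<open>1\<close>. Since
  the topology is zero-dimensional, every \<open>a \<in> F\<^sub>0\<close> is then topologically indistinguishable from
  \<open>1\<close>. If \<open>y \<in> x/F\<^sub>0\<close>, put \<open>a = x \<rightharpoonup> y \<in> F\<^sub>0\<close>; then \<open>x * a \<le> y\<close>, so by continuity
  \<open>y = sup (x * a) y\<close> is indistinguishable from \<open>sup (x * 1) y = sup x y\<close>, and symmetrically so
  is \<open>x\<close>. Hence open sets are unions of classes modulo \<open>F\<^sub>0\<close>, and these classes are open.
\<close>

lemma base_of_openin:
  assumes "base_of \<beta> T" "B \<in> \<beta>"
  shows "openin T B"
  using assms by (simp add: base_of_def arbitrary_union_of_inc)

lemma base_of_subset:
  assumes "base_of \<beta> T" "openin T U" "x \<in> U"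
  obtains B where "B \<in> \<beta>" "x \<in> B" "B \<subseteq> U"
proof -
  have "(arbitrary union_of (\<lambda>B. B \<in> \<beta>)) U"
    using assms(1,2) by (simp add: base_of_def)
  then show ?thesis
    using assms(3) that unfolding union_of_def by blast
qed

text \<open>This relation stands in for equality: the topology may fail to be Kolmogorov, so
  distinct points may share all their neighbourhoods.\<close>

definition topologically_indistinguishable :: "'a topology \<Rightarrow> 'a \<Rightarrow> 'a \<Rightarrow> bool" where
  "topologically_indistinguishable T x y \<longleftrightarrow> (\<forall>U. openin T U \<longrightarrow> x \<in> U \<longleftrightarrow> y \<in> U)"

lemma topologically_indistinguishable_continuous_map:
  assumes f: "continuous_map S T f" and "x \<in> topspace S" "y \<in> topspace S"
    and xy: "topologically_indistinguishable S x y"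
  shows "topologically_indistinguishable T (f x) (f y)"
  unfolding topologically_indistinguishable_def
proof (intro allI impI)
  fix U assume "openin T U"
  then have "openin S {z \<in> topspace S. f z \<in> U}"
    using f by (simp add: openin_continuous_map_preimage)
  then show "f x \<in> U \<longleftrightarrow> f y \<in> U"
    using xy assms(2,3) unfolding topologically_indistinguishable_def by blast
qed

text \<open>A clopen basic set containing \<open>y\<close> but not \<open>x\<close> would have an
  open complement containing \<open>x\<close> but not \<open>y\<close>, against \<open>spec\<close>.
  So the one-sided condition becomes symmetric.\<close>

lemma zero_dimensional_imp_topologically_indistinguishable:
  assumes "zero_dimensional T" and "x \<in> topspace T" "y \<in> topspace T"
    and spec: "\<And>U. openin T U \<Longrightarrow> x \<in> U \<Longrightarrow> y \<in> U"
  shows "topologically_indistinguishable T x y"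
  unfolding topologically_indistinguishable_def
proof (intro allI impI iffI)
  fix U assume U: "openin T U" and "y \<in> U"
  obtain \<B> where \<B>: "base_of \<B> T" and clopen: "\<And>B. B \<in> \<B> \<Longrightarrow> openin T B \<and> closedin T B"
    using assms(1) unfolding zero_dimensional_def by blast
  obtain B where B: "B \<in> \<B>" "y \<in> B" "B \<subseteq> U"
    using base_of_subset[OF \<B> U \<open>y \<in> U\<close>] .
  have "openin T (topspace T - B)"
    using clopen[OF B(1)] by blast
  then have "x \<in> B"
    using spec \<open>x \<in> topspace T\<close> \<open>y \<in> B\<close> by blast
  then show "x \<in> U"
    using B by blast
qed (use spec in blast)

lemma rl_filter_one:
  assumes "rl_filter F"
  shows "1 \<in> F"
  using assms top_greatest unfolding rl_filter_def one_eq_top by blast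

text \<open>The unit is the top element, so a product lies below each of its factors, and filters
  are upward closed.\<close>

lemma rl_filter_multD:
  assumes "rl_filter F" "x * y \<in> F"
  shows "x \<in> F" "y \<in> F"
proof -
  have le: "u * v \<le> v" for u v :: 'a
  proof -
    have "1 \<le> v \<rightharpoonup> v"
      using residuation[of 1 v v] by simp
    then have "u \<le> v \<rightharpoonup> v"
      by (simp add: one_eq_top top_unique)
    then show ?thesis
      by (simp add: residuation)
  qed
  have up: "\<And>u v. u \<in> F \<Longrightarrow> u \<le> v \<Longrightarrow> v \<in> F"
    using assms(1) unfolding rl_filter_def by blast
  show "x \<in> F"
    using up[OF assms(2)] le[of y x] by (simp add: mult.commute)
  show "y \<in> F"
    using up[OF assms(2) le] .
qed

lemma mem_filter_class_self:
  assumes "rl_filter F"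
  shows "x \<in> filter_class x F"
proof -
  have "1 \<le> x \<rightharpoonup> x"
    using residuation[of 1 x x] by simp
  then have "x \<rightharpoonup> x = 1"
    by (simp add: one_eq_top top_unique)
  then show ?thesis
    using rl_filter_one[OF assms] by (simp add: filter_class_def)
qed

lemma linear_topology_filter_nhd:
  assumes "linear_topology T" "openin T U" "1 \<in> U"
  obtains F where "rl_filter F" "openin T F" "F \<subseteq> U"
proof -
  obtain \<beta> where \<beta>: "base_of \<beta> T" "\<forall>B\<in>\<beta>. rl_filter B \<longleftrightarrow> 1 \<in> B"
    using assms(1) unfolding linear_topology_def by blast
  obtain B where "B \<in> \<beta>" "1 \<in> B" "B \<subseteq> U"
    using base_of_subset[OF \<beta>(1) assms(2,3)] .
  then show ?thesis
    using \<beta> base_of_openin that by blast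
qed

text \<open>Otherwise dependent choice would yield an infinite strictly descending sequence of
  filters. \<open>P\<close> is left general so that minimality can be taken among open
  filters.\<close>

lemma filter_dcc_minimal:
  fixes P :: "'a::residuated_lattice set \<Rightarrow> bool"
  assumes "filter_dcc TYPE('a)" and "\<And>F. P F \<Longrightarrow> rl_filter F" and "P G"
  obtains F where "P F" "\<And>H. P H \<Longrightarrow> \<not> H \<subset> F"
proof (rule ccontr)
  assume "\<not> thesis"
  with that have smaller: "\<And>F. P F \<Longrightarrow> \<exists>H. P H \<and> H \<subset> F"
    by blast
  have "\<exists>f. \<forall>n. P (f n) \<and> f (Suc n) \<subset> f n"
    by (rule dependent_nat_choice[of "\<lambda>_. P" "\<lambda>_ F H. H \<subset> F"])
      (use \<open>P G\<close> smaller in blast)+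
  then obtain f where f: "\<forall>n. P (f n) \<and> f (Suc n) \<subset> f n" ..
  have "(\<forall>n. rl_filter (f n)) \<and> (\<forall>n. f (Suc n) \<subset> f n)"
    using f assms(2) by simp
  then have "\<not> filter_dcc TYPE('a)"
    unfolding filter_dcc_def not_not by (intro exI[of _ f])
  then show False
    using assms(1) by contradiction
qed

lemma least_open_filter:
  fixes T :: "'a::residuated_lattice topology"
  assumes "filter_dcc TYPE('a)" "linear_topology T" "1 \<in> topspace T"
  obtains F where "rl_filter F" "openin T F" "\<And>U. openin T U \<Longrightarrow> 1 \<in> U \<Longrightarrow> F \<subseteq> U"
proof -
  obtain G where "rl_filter G \<and> openin T G"
    using linear_topology_filter_nhd[OF assms(2) openin_topspace assms(3)] by blast
  then obtain F where F: "rl_filter F \<and> openin T F"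
    and min: "\<And>H. rl_filter H \<and> openin T H \<Longrightarrow> \<not> H \<subset> F"
    using filter_dcc_minimal[OF assms(1), of "\<lambda>F. rl_filter F \<and> openin T F"] by blast
  have "F \<subseteq> U" if "openin T U" "1 \<in> U" for U
  proof -
    \<comment> \<open>An open filter inside \<open>U \<inter> F\<close> cannot be a proper subset of
      \<open>F\<close>, so it equals \<open>F\<close>. This turns the minimal open filter into the
      least one.\<close>
    have "openin T (U \<inter> F)" "1 \<in> U \<inter> F"
      using F that rl_filter_one by auto
    then obtain H where "rl_filter H" "openin T H" "H \<subseteq> U \<inter> F"
      using linear_topology_filter_nhd[OF assms(2)] by blast
    then show ?thesis
      using min by blast
  qed
  then show ?thesis
    using F that by blast
qed

context
  fixes T :: "'a::residuated_lattice topology"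
  assumes T: "topological_residuated_lattice T"
begin

lemma topspace_eq_UNIV: "topspace T = UNIV"
  using T by (simp add: topological_residuated_lattice_def)

text \<open>Used as introduction rules, these reduce continuity of a one-variable term to that of
  its variable and constants.\<close>

lemma continuous_map_operations:
  assumes "continuous_map S T f" "continuous_map S T g"
  shows "continuous_map S T (\<lambda>z. sup (f z) (g z))"
    and "continuous_map S T (\<lambda>z. f z * g z)"
    and "continuous_map S T (\<lambda>z. f z \<rightharpoonup> g z)"
proof -
  have pair: "continuous_map S (prod_topology T T) (\<lambda>z. (f z, g z))"
    using assms by (simp add: continuous_map_pairedI)
  have "continuous_map S T (\<lambda>z. h (f z) (g z))"
    if "continuous_map (prod_topology T T) T (\<lambda>(x, y). h x y)" for h
    using continuous_map_compose[OF pair that] by (simp add: o_def)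
  then show "continuous_map S T (\<lambda>z. sup (f z) (g z))"
    and "continuous_map S T (\<lambda>z. f z * g z)"
    and "continuous_map S T (\<lambda>z. f z \<rightharpoonup> g z)"
    using T unfolding topological_residuated_lattice_def by blast+
qed

text \<open>The class is the preimage of \<open>F\<close> under a term function continuous in
  \<open>y\<close>.\<close>

lemma openin_filter_class:
  assumes "openin T F"
  shows "openin T (filter_class x F)"
proof -
  have "continuous_map T T (\<lambda>y. (x \<rightharpoonup> y) * (y \<rightharpoonup> x))"
    using topspace_eq_UNIV by (intro continuous_map_operations) auto
  from openin_continuous_map_preimage[OF this assms]
  show ?thesis
    by (simp add: filter_class_def topspace_eq_UNIV)
qed

lemma topologically_indistinguishable_sup:
  assumes "topologically_indistinguishable T 1 (x \<rightharpoonup> y)"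
  shows "topologically_indistinguishable T (sup x y) y"
proof -
  \<comment> \<open>This map sends \<open>1\<close> to \<open>sup x y\<close> and
    \<open>x \<rightharpoonup> y\<close> to \<open>y\<close>, the latter because
    \<open>x * (x \<rightharpoonup> y) \<le> y\<close>.\<close>
  have "continuous_map T T (\<lambda>z. sup (x * z) y)"
    using topspace_eq_UNIV by (intro continuous_map_operations) auto
  then have "topologically_indistinguishable T (sup (x * 1) y) (sup (x * (x \<rightharpoonup> y)) y)"
    by (rule topologically_indistinguishable_continuous_map[where f = "\<lambda>z. sup (x * z) y"])
      (simp_all add: topspace_eq_UNIV assms)
  moreover have "x * (x \<rightharpoonup> y) \<le> y"
    using residuation[of "x \<rightharpoonup> y" x y] by (simp add: mult.commute)
  ultimately show ?thesis
    by (simp add: sup_absorb2)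
qed

lemma topologically_indistinguishable_filter_class:
  assumes F: "rl_filter F" "\<And>a. a \<in> F \<Longrightarrow> topologically_indistinguishable T 1 a"
    and "y \<in> filter_class x F"
  shows "topologically_indistinguishable T x y"
proof -
  have "x \<rightharpoonup> y \<in> F" "y \<rightharpoonup> x \<in> F"
    using assms(3) rl_filter_multD[OF F(1)] unfolding filter_class_def by blast+
  \<comment> \<open>The join is symmetric in \<open>x\<close> and \<open>y\<close>, so it links the
    two points, one residuum serving each side.\<close>
  then have "topologically_indistinguishable T (sup x y) y"
    "topologically_indistinguishable T (sup x y) x"
    using F(2) topologically_indistinguishable_sup[of x y]
      topologically_indistinguishable_sup[of y x] by (simp_all add: sup_commute)
  then show ?thesis
    by (simp add: topologically_indistinguishable_def)
qed

text \<open>Indistinguishability makes every open set of \<open>T\<close> a union of classes.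
  Conversely, openness of \<open>F\<close> makes each class an open neighbourhood of its
  representative, so unions of classes are open.\<close>

lemma eq_filter_topology:
  assumes "rl_filter F" "openin T F"
    and "\<And>a. a \<in> F \<Longrightarrow> topologically_indistinguishable T 1 a"
  shows "T = filter_topology F"
  unfolding topology_eq openin_filter_topology
proof (intro allI iffI ballI)
  fix U x
  assume "openin T U" "x \<in> U"
  then show "filter_class x F \<subseteq> U"
    using topologically_indistinguishable_filter_class[OF assms(1,3)]
    unfolding topologically_indistinguishable_def by blast
next
  fix U
  assume "\<forall>x\<in>U. filter_class x F \<subseteq> U"
  then show "openin T U"
    using openin_filter_class[OF assms(2)] mem_filter_class_self[OF assms(1)]
    by (subst openin_subopen) blast
qed

end

lemma filter_system_singleton: "filter_system {F} \<longleftrightarrow> rl_filter F"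
  by (simp add: filter_system_def)

lemma system_topology_singleton: "system_topology {F} = filter_topology F"
  by (simp add: system_topology_def filter_topology_def)

theorem theorem5p4:
  fixes \<U> :: "'a::residuated_lattice topology"
  assumes "filter_dcc TYPE('a)"
    and "topological_residuated_lattice \<U>"
    and "linear_topology \<U>"
    and "zero_dimensional \<U>"
  shows "\<exists>F\<^sub>0. rl_filter F\<^sub>0 \<and> \<U> = filter_topology F\<^sub>0 \<and>
           filter_system {F\<^sub>0} \<and> \<U> = system_topology {F\<^sub>0}"
proof -
  note top = topspace_eq_UNIV[OF assms(2)]
  obtain F where F: "rl_filter F" "openin \<U> F" "\<And>U. openin \<U> U \<Longrightarrow> 1 \<in> U \<Longrightarrow> F \<subseteq> U"
    using least_open_filter[OF assms(1,3)] top by auto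
  \<comment> \<open>\<open>F(3)\<close> only says that open sets containing \<open>1\<close> contain
    \<open>a\<close>; zero-dimensionality supplies the converse.\<close>
  have "topologically_indistinguishable \<U> 1 a" if "a \<in> F" for a
    using zero_dimensional_imp_topologically_indistinguishable[OF assms(4)] F(3) that top by blast
  then have "\<U> = filter_topology F"
    using eq_filter_topology[OF assms(2) F(1,2)] by blast
  then show ?thesis
    using F(1) by (auto simp: filter_system_singleton system_topology_singleton)
qed

end
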